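(* Let $G_1,G_2$ be connected graphs with $n\ge2$ and $m\ge2$ nodes and algebraic connectivities $\lambda_2^{(1)},\lambda_2^{(2)}$, and let all $nm$ interlayer links be admissible. Put $c^*=\min\{m\lambda_2^{(1)},\,n\lambda_2^{(2)}\}$. Then for every $0\le c\le c^*$ the uniform weight distribution $w_{ij}=c/(nm)$ is a solution of the problem of maximizing $\lambda_2[L(W)]$ over all nonnegative $n\times m$ matrices $W$ with $\boldsymbol 1_n^TW\boldsymbol 1_m=c$, and the maximum value is $\left(\frac1n+\frac1m\right)c$.
   Context: $G_1,G_2$ are finite undirected unweighted connected graphs with Laplacian matrices $L_1$ ($n\times n$) and $L_2$ ($m\times m$). The algebraic connectivity $\lambda_2[\cdot]$ of a Laplacian is its second smallest eigenvalue counted with multiplicity; $\lambda_2^{(k)}=\lambda_2[L_k]$. For a nonnegative $n\times m$ interlayer weight matrix $W$ the supra-Laplacian is $$L(W)=\begin{bmatrix} L_1+\mathrm{diag}(W\boldsymbol 1_m) & -W\\ -W^T & L_2+\mathrm{diag}(W^T\boldsymbol 1_n)\end{bmatrix},$$ with $\boldsymbol 1_k$ the all-ones vector in $\mathbb R^k$. *)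

theory Defs
  imports "Jordan_Normal_Form.Char_Poly" "Graph_Theory.Graph_Theory"
begin

(* An undirected simple graph is a pair_graph (finite, loop-free, symmetric arc set);
   nodes are labelled 0, ..., n-1 so that they index the rows of its matrices. *)
definition graph_on :: "nat \<Rightarrow> nat pair_pre_digraph \<Rightarrow> bool" where
  "graph_on n G \<longleftrightarrow> pair_graph G \<and> pverts G = {..<n}"

definition adjacency_mat :: "nat pair_pre_digraph \<Rightarrow> real mat" where
  "adjacency_mat G = mat (card (pverts G)) (card (pverts G))
     (\<lambda>(i, j). if (i, j) \<in> parcs G then 1 else 0)"

definition laplacian :: "nat pair_pre_digraph \<Rightarrow> real mat" where
  "laplacian G = mat_diag (card (pverts G)) (\<lambda>i. real (out_degree (with_proj G) i)) - adjacency_mat G"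

(* Real roots of the characteristic polynomial, repeated according to multiplicity.
   The matrices below are real symmetric, so no eigenvalue is lost by not passing to
   the complex numbers.  Only meaningful in dimension at least 2. *)
definition eigenvalue_list :: "real mat \<Rightarrow> real list" where
  "eigenvalue_list A = sorted_list_of_multiset (proots (char_poly A))"

definition algebraic_connectivity :: "real mat \<Rightarrow> real" where
  "algebraic_connectivity L = eigenvalue_list L ! 1"

definition ones :: "nat \<Rightarrow> real vec" where
  "ones k = vec k (\<lambda>_. 1)"

definition diag_of_vec :: "real vec \<Rightarrow> real mat" where
  "diag_of_vec v = mat_diag (dim_vec v) (\<lambda>i. v $ i)"

definition supra_laplacian :: "real mat \<Rightarrow> real mat \<Rightarrow> real mat \<Rightarrow> real mat" where
  "supra_laplacian L1 L2 W = four_block_mat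
     (L1 + diag_of_vec (W *\<^sub>v ones (dim_col W))) (- W)
     (- W\<^sup>T) (L2 + diag_of_vec (W\<^sup>T *\<^sub>v ones (dim_row W)))"

definition admissible_weights :: "nat \<Rightarrow> nat \<Rightarrow> real \<Rightarrow> real mat set" where
  "admissible_weights n m c = {W \<in> carrier_mat n m.
     (\<forall>i<n. \<forall>j<m. 0 \<le> W $$ (i, j)) \<and> ones n \<bullet> (W *\<^sub>v ones m) = c}"

end

(* For a symmetric positive semidefinite matrix of row sums zero, the second smallest eigenvalue is
   the best constant t with t |x|^2 <= x.Lx for all x orthogonal to the all-ones vector.  The test
   vector (m,...,m,-n,...,-n) has |x|^2 = nm(n+m) and x.L(W)x = c (n+m)^2, whence the upper bound for
   every admissible W.  For uniform W, split x = (u,v) with 1.u = s = -1.v: the layers contribute at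
   least lambda^(1) (|u|^2 - s^2/n) + lambda^(2) (|v|^2 - s^2/m), and the links exactly
   c/(nm) (m|u|^2 + n|v|^2 + 2s^2).  As lambda^(1) >= c/m and lambda^(2) >= c/n, the terms in s cancel
   and the bound (1/n + 1/m) c |x|^2 remains. *)
theory Submission
  imports Defs
begin

section \<open>Quadratic forms and eigenvalues of symmetric matrices\<close>

lemma smult_zero_vec: "a \<cdot>\<^sub>v 0\<^sub>v N = (0\<^sub>v N :: 'a :: mult_zero vec)"
  by (intro eq_vecI) auto

lemma scalar_prod_self_nonneg: "0 \<le> x \<bullet> (x :: real vec)"
  by (auto simp: scalar_prod_def intro: sum_nonneg)

lemma scalar_prod_self_eq_0:
  assumes "x \<in> carrier_vec N" and "x \<bullet> (x :: real vec) = 0"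
  shows "x = 0\<^sub>v N"
  using assms by (auto simp: scalar_prod_def sum_nonneg_eq_0_iff intro!: eq_vecI)

lemma symmetric_scalar_prod_mult:
  fixes A :: "real mat"
  assumes "A \<in> carrier_mat N N" "A\<^sup>T = A" "x \<in> carrier_vec N" "y \<in> carrier_vec N"
  shows "x \<bullet> (A *\<^sub>v y) = y \<bullet> (A *\<^sub>v x)"
  using transpose_vec_mult_scalar[of A N N y x] comm_scalar_prod[of "A *\<^sub>v x" N y] assms by auto

lemma quadratic_form_bounded:
  fixes A :: "real mat"
  assumes A: "A \<in> carrier_mat N N"
  obtains K where "0 < K" "\<And>x. x \<in> carrier_vec N \<Longrightarrow> \<bar>x \<bullet> (A *\<^sub>v x)\<bar> \<le> K * (x \<bullet> x)"
proof
  \<comment> \<open>The summand 1 keeps the constant positive even if all entries vanish, so that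
    later arguments can divide by it.\<close>
  let ?K = "1 + (\<Sum>i<N. \<Sum>j<N. \<bar>A $$ (i, j)\<bar>)"
  show "0 < ?K" by (smt (verit) sum_nonneg abs_ge_zero)
  fix x :: "real vec" assume x: "x \<in> carrier_vec N"
  have le: "(x $ i)\<^sup>2 \<le> x \<bullet> x" if "i < N" for i
    using that x member_le_sum[of i "{0..<N}" "\<lambda>i. x $ i * x $ i"]
    by (auto simp: scalar_prod_def power2_eq_square)
  have "\<bar>x \<bullet> (A *\<^sub>v x)\<bar> = \<bar>\<Sum>i<N. \<Sum>j<N. A $$ (i, j) * (x $ i * x $ j)\<bar>"
    using A x by (simp add: scalar_prod_def sum_distrib_left atLeast0LessThan mult_ac)
  also have "\<dots> \<le> (\<Sum>i<N. \<Sum>j<N. \<bar>A $$ (i, j) * (x $ i * x $ j)\<bar>)"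
    by (intro order_trans[OF sum_abs] sum_mono) simp
  also have "\<dots> \<le> (\<Sum>i<N. \<Sum>j<N. \<bar>A $$ (i, j)\<bar> * (x \<bullet> x))"
  proof (intro sum_mono)
    fix i j assume "i \<in> {..<N}" "j \<in> {..<N}"
    then have "\<bar>x $ i\<bar> * \<bar>x $ j\<bar> \<le> x \<bullet> x"
      using le[of i] le[of j] sum_squares_bound[of "\<bar>x $ i\<bar>" "\<bar>x $ j\<bar>"] by simp
    then show "\<bar>A $$ (i, j) * (x $ i * x $ j)\<bar> \<le> \<bar>A $$ (i, j)\<bar> * (x \<bullet> x)"
      by (simp add: abs_mult mult_left_mono)
  qed
  also have "\<dots> \<le> ?K * (x \<bullet> x)"
    using scalar_prod_self_nonneg[of x] by (simp only: sum_distrib_right[symmetric]) (simp add: distrib_right)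
  finally show "\<bar>x \<bullet> (A *\<^sub>v x)\<bar> \<le> ?K * (x \<bullet> x)" .
qed

text \<open>Testing semidefiniteness on \<open>x - (1/K) C x\<close>, where \<open>K\<close> bounds
  the form of \<open>C\<close>, leaves exactly this estimate. It turns a lower bound on the norm of
  \<open>C x\<close> into one on the form of \<open>C\<close>.\<close>

lemma psd_mult_norm_bounded:
  fixes C :: "real mat"
  assumes C: "C \<in> carrier_mat N N" "C\<^sup>T = C"
    and psd: "\<And>x. x \<in> carrier_vec N \<Longrightarrow> 0 \<le> x \<bullet> (C *\<^sub>v x)"
  obtains K where "0 < K" "\<And>x. x \<in> carrier_vec N \<Longrightarrow> (C *\<^sub>v x) \<bullet> (C *\<^sub>v x) \<le> K * (x \<bullet> (C *\<^sub>v x))"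
proof -
  obtain K where K: "0 < K" "\<And>x. x \<in> carrier_vec N \<Longrightarrow> \<bar>x \<bullet> (C *\<^sub>v x)\<bar> \<le> K * (x \<bullet> x)"
    using quadratic_form_bounded[OF C(1)] by blast
  show thesis
  proof (rule that[OF K(1)])
    fix x :: "real vec" assume x: "x \<in> carrier_vec N"
    let ?y = "C *\<^sub>v x"
    let ?z = "C *\<^sub>v ?y"
    have y: "?y \<in> carrier_vec N" and z: "?z \<in> carrier_vec N" using C x by auto
    have "0 \<le> (x - (1 / K) \<cdot>\<^sub>v ?y) \<bullet> (C *\<^sub>v (x - (1 / K) \<cdot>\<^sub>v ?y))"
      by (rule psd) (use x y in auto)
    also have "C *\<^sub>v (x - (1 / K) \<cdot>\<^sub>v ?y) = ?y - (1 / K) \<cdot>\<^sub>v ?z"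
      using C x y by (simp add: mult_minus_distrib_mat_vec mult_mat_vec)
    also have "(x - (1 / K) \<cdot>\<^sub>v ?y) \<bullet> \<dots> = x \<bullet> ?y - (1 / K) * (x \<bullet> ?z) - (1 / K) * (?y \<bullet> ?y)
        + (1 / K)\<^sup>2 * (?y \<bullet> ?z)"
      using x y z C
      by (simp add: minus_scalar_prod_distrib[of _ N] scalar_prod_minus_distrib[of _ N] power2_eq_square
          smult_scalar_prod_distrib[of _ N] scalar_prod_smult_distrib[of _ N] algebra_simps)
    also have "x \<bullet> ?z = ?y \<bullet> ?y"
      using symmetric_scalar_prod_mult[OF C x y] .
    also have "(1 / K)\<^sup>2 * (?y \<bullet> ?z) \<le> (1 / K)\<^sup>2 * (K * (?y \<bullet> ?y))"
      using K(2)[OF y] by (intro mult_left_mono) auto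
    finally show "?y \<bullet> ?y \<le> K * (x \<bullet> ?y)"
      using K(1) by (simp add: field_simps power2_eq_square)
  qed
qed

section \<open>Eigenvalues and lower bounds of the Rayleigh quotient\<close>

lemma char_matrix_symmetric:
  assumes "A \<in> carrier_mat N N" "A\<^sup>T = A"
  shows "(char_matrix A s)\<^sup>T = char_matrix A s"
  using assms by (intro eq_matI) (auto simp: char_matrix_def mat_eq_iff)

lemma char_matrix_quadratic_form:
  fixes A :: "real mat"
  assumes "A \<in> carrier_mat N N" "x \<in> carrier_vec N"
  shows "x \<bullet> (char_matrix A s *\<^sub>v x) = x \<bullet> (A *\<^sub>v x) - s * (x \<bullet> x)"
proof -
  have "((- s) \<cdot>\<^sub>m 1\<^sub>m N) *\<^sub>v x = (- s) \<cdot>\<^sub>v x"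
    using assms by (intro eq_vecI) (auto simp: smult_scalar_prod_distrib[of _ N])
  then show ?thesis
    using assms by (simp add: char_matrix_def add_mult_distrib_mat_vec[of _ N N] scalar_prod_add_distrib[of _ N])
qed

text \<open>The best lower bound of the Rayleigh quotient is an eigenvalue: otherwise the shifted
  positive semidefinite matrix is invertible, and its form could be bounded away from zero.\<close>

lemma symmetric_quadratic_form_ge:
  fixes B :: "real mat"
  assumes B: "B \<in> carrier_mat N N" "B\<^sup>T = B"
    and ev: "\<And>e. eigenvalue B e \<Longrightarrow> t \<le> e"
    and x: "x \<in> carrier_vec N"
  shows "t * (x \<bullet> x) \<le> x \<bullet> (B *\<^sub>v x)"
proof (cases "x = 0\<^sub>v N")
  case True
  then show ?thesis using B by simp
next
  case False
  define S where "S = {s. \<forall>y\<in>carrier_vec N. s * (y \<bullet> y) \<le> y \<bullet> (B *\<^sub>v y)}"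
  define s where "s = Sup S"
  have xx: "0 < x \<bullet> x"
    using scalar_prod_self_eq_0[OF x] scalar_prod_self_nonneg[of x] False by fastforce
  obtain K where K: "\<And>y. y \<in> carrier_vec N \<Longrightarrow> \<bar>y \<bullet> (B *\<^sub>v y)\<bar> \<le> K * (y \<bullet> y)"
    using quadratic_form_bounded[OF B(1)] by blast
  have ne: "- K \<in> S" using K by (fastforce simp: S_def abs_le_iff)
  have bdd: "bdd_above S"
    by (rule bdd_aboveI[of _ "(x \<bullet> (B *\<^sub>v x)) / (x \<bullet> x)"])
      (use x xx in \<open>auto simp: S_def pos_le_divide_eq\<close>)
  \<comment> \<open>The supremum belongs to \<open>S\<close>: every Rayleigh quotient is an upper
    bound of \<open>S\<close>, hence at least \<open>s\<close>.\<close>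
  have sS: "s * (y \<bullet> y) \<le> y \<bullet> (B *\<^sub>v y)" if y: "y \<in> carrier_vec N" for y
  proof (cases "y \<bullet> y = 0")
    case True
    then show ?thesis using scalar_prod_self_eq_0[OF y] B by auto
  next
    case False
    then have yy: "0 < y \<bullet> y" using scalar_prod_self_nonneg[of y] by linarith
    have "s \<le> (y \<bullet> (B *\<^sub>v y)) / (y \<bullet> y)"
      unfolding s_def by (rule cSup_least) (use ne in blast, use y yy in \<open>auto simp: S_def pos_le_divide_eq\<close>)
    then show ?thesis using yy by (simp add: pos_le_divide_eq)
  qed
  define C where "C = char_matrix B s"
  have C: "C \<in> carrier_mat N N" "C\<^sup>T = C"
    using B char_matrix_symmetric by (auto simp: C_def)
  have Cq: "y \<bullet> (C *\<^sub>v y) = y \<bullet> (B *\<^sub>v y) - s * (y \<bullet> y)" if "y \<in> carrier_vec N" for y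
    using char_matrix_quadratic_form[OF B(1) that] by (simp add: C_def)
  obtain K1 where K1: "0 < K1"
    "\<And>y. y \<in> carrier_vec N \<Longrightarrow> (C *\<^sub>v y) \<bullet> (C *\<^sub>v y) \<le> K1 * (y \<bullet> (C *\<^sub>v y))"
    using psd_mult_norm_bounded[OF C] sS Cq by (smt (verit))
  have "det C = 0"
  proof (rule ccontr)
    assume "det C \<noteq> 0"
    then obtain D where D: "D \<in> carrier_mat N N" "D * C = 1\<^sub>m N"
      using det_non_zero_imp_unit[OF C(1)] by (auto simp: Units_def ring_mat_def)
    obtain K2 where K2: "0 < K2"
      "\<And>y. y \<in> carrier_vec N \<Longrightarrow> \<bar>y \<bullet> ((D\<^sup>T * D) *\<^sub>v y)\<bar> \<le> K2 * (y \<bullet> y)"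
      using quadratic_form_bounded[of "D\<^sup>T * D" N] D by auto
    \<comment> \<open>Since \<open>D\<close> inverts \<open>C\<close>, |y|^2 = |D C y|^2 \<le> K2 |C
      y|^2 \<le> K2 K1 (y . C y). So the form of \<open>B\<close> exceeds s |y|^2 by a fixed
      multiple of |y|^2, and \<open>s\<close> could be enlarged.\<close>
    have "s + 1 / (K2 * K1) \<in> S"
      unfolding S_def
    proof (intro CollectI ballI)
      fix y :: "real vec" assume y: "y \<in> carrier_vec N"
      let ?z = "C *\<^sub>v y"
      have z: "?z \<in> carrier_vec N" using C y by auto
      have Dz: "D *\<^sub>v ?z = y"
        using D y C by (metis assoc_mult_mat_vec one_mult_mat_vec)
      have "y \<bullet> y = ?z \<bullet> ((D\<^sup>T * D) *\<^sub>v ?z)"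
        using transpose_vec_mult_scalar[of D N N ?z y] D z y Dz comm_scalar_prod[of ?z N "D\<^sup>T *\<^sub>v y"]
        by (simp add: assoc_mult_mat_vec[of _ N N])
      also have "\<dots> \<le> K2 * (?z \<bullet> ?z)" using K2(2)[OF z] by linarith
      also have "\<dots> \<le> K2 * (K1 * (y \<bullet> ?z))" using K1(2)[OF y] K2(1) by simp
      finally have "1 / (K2 * K1) * (y \<bullet> y) \<le> y \<bullet> ?z"
        using K1(1) K2(1) by (simp add: field_simps)
      then show "(s + 1 / (K2 * K1)) * (y \<bullet> y) \<le> y \<bullet> (B *\<^sub>v y)"
        using Cq[OF y] by (simp add: algebra_simps)
    qed
    then have "s + 1 / (K2 * K1) \<le> s" unfolding s_def using bdd by (rule cSup_upper)
    moreover have "0 < 1 / (K2 * K1)" using K1(1) K2(1) by simp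
    ultimately show False by linarith
  qed
  \<comment> \<open>A singular \<open>C\<close> makes \<open>s\<close> an eigenvalue of
    \<open>B\<close>, so the spectral hypothesis applies to \<open>s\<close>.\<close>
  then have "t \<le> s" using ev eigenvalue_det[OF B(1)] by (simp add: C_def)
  then show ?thesis using sS[OF x] xx by (smt (verit) mult_right_mono)
qed

lemma eigenvalue_ge:
  fixes B :: "real mat"
  assumes B: "B \<in> carrier_mat N N"
    and q: "\<And>x. x \<in> carrier_vec N \<Longrightarrow> t * (x \<bullet> x) \<le> x \<bullet> (B *\<^sub>v x)"
    and e: "eigenvalue B e"
  shows "t \<le> e"
proof -
  obtain v where v: "v \<in> carrier_vec N" "v \<noteq> 0\<^sub>v N" "B *\<^sub>v v = e \<cdot>\<^sub>v v"
    using e B by (auto simp: eigenvalue_def eigenvector_def)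
  have "0 < v \<bullet> v"
    using scalar_prod_self_eq_0[OF v(1)] scalar_prod_self_nonneg[of v] v(2) by fastforce
  then show ?thesis using q[OF v(1)] v by simp
qed

section \<open>Algebraic connectivity and the Rayleigh quotient\<close>

abbreviation ones_mat :: "nat \<Rightarrow> real mat" where
  "ones_mat N \<equiv> mat N N (\<lambda>_. 1)"

text \<open>Rank-one case of det (I + XY) = det (I + YX): the block factor \<open>?E\<close> clears
  the lower left block of \<open>?M\<close> from either side, which leaves an N-dimensional Schur
  complement in one product and a scalar one in the other.\<close>

lemma det_one_plus_ones_mat:
  "det (1\<^sub>m N + r \<cdot>\<^sub>m ones_mat N) = 1 + r * real N"
proof -
  let ?R = "mat 1 N (\<lambda>_. - 1 :: real)" and ?C = "mat N 1 (\<lambda>_. r)"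
  let ?M = "four_block_mat (1\<^sub>m 1) ?R ?C (1\<^sub>m N)"
  let ?E = "four_block_mat (1\<^sub>m 1) (0\<^sub>m 1 N) (- ?C) (1\<^sub>m N)"
  have M: "?M \<in> carrier_mat (1 + N) (1 + N)" and E: "?E \<in> carrier_mat (1 + N) (1 + N)"
    by (auto intro!: four_block_carrier_mat)
  have [simp]: "- ?C * ?R = r \<cdot>\<^sub>m ones_mat N" "?R * - ?C = mat 1 1 (\<lambda>_. r * real N)"
    by (auto intro!: eq_matI simp: scalar_prod_def)
  have EM: "?E * ?M = four_block_mat (1\<^sub>m 1) ?R (0\<^sub>m N 1) (1\<^sub>m N + r \<cdot>\<^sub>m ones_mat N)"
    by (subst mult_four_block_mat[of _ 1 1 _ N _ N _ _ 1 _ N])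
       (auto intro!: cong_four_block_mat eq_matI simp: scalar_prod_def)
  have ME: "?M * ?E = four_block_mat (mat 1 1 (\<lambda>_. 1 + r * real N)) ?R (0\<^sub>m N 1) (1\<^sub>m N)"
    by (subst mult_four_block_mat[of _ 1 1 _ N _ N _ _ 1 _ N])
       (auto intro!: cong_four_block_mat eq_matI simp: scalar_prod_def)
  (* Both products are block triangular, and their determinants agree. *)
  have "det (?E * ?M) = det (?M * ?E)"
    using M E by (simp add: det_mult[of _ "1 + N"])
  then show ?thesis
    unfolding EM ME
    by (subst (asm) (1 2) det_four_block_mat_lower_left_zero[of _ 1 _ N])
       (auto simp: det_single)
qed

text \<open>A case of Brauer's rank-one perturbation theorem: the eigenvalue 0 of the all-ones
  vector moves to \<open>s * real N\<close>, all others stay with their multiplicities. The two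
  linear factors avoid a division of polynomials.\<close>

lemma char_poly_add_ones_mat:
  fixes A :: "real mat"
  assumes A: "A \<in> carrier_mat N N" and A1: "A *\<^sub>v ones N = 0\<^sub>v N" and "0 < N"
  shows "char_poly (A + s \<cdot>\<^sub>m ones_mat N) * [:0, 1:] = char_poly A * [:- (s * real N), 1:]"
proof (rule poly_eq_poly_eq_iff[THEN iffD1], rule ext)
  fix x :: real
  let ?P = "A + s \<cdot>\<^sub>m ones_mat N"
  define M where "M = - char_matrix A x"
  have M: "M \<in> carrier_mat N N" using A by (simp add: M_def)
  have rowsum: "(\<Sum>j\<in>{0..<N}. A $$ (i, j)) = 0" if "i < N" for i
    using arg_cong[OF A1, of "\<lambda>v. v $ i"] A that by (simp add: scalar_prod_def ones_def)
  show "poly (char_poly ?P * [:0, 1:]) x = poly (char_poly A * [:- (s * real N), 1:]) x"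
  proof (cases "x = 0")
    \<comment> \<open>Here the factorization below would divide by zero; instead both sides vanish,
      the right one because 0 is an eigenvalue of \<open>A\<close>.\<close>
    case True
    have "ones N \<noteq> 0\<^sub>v N" using \<open>0 < N\<close> by (auto simp: ones_def vec_eq_iff)
    then have "eigenvector A (ones N) 0"
      using A A1 by (auto simp: eigenvector_def ones_def intro!: eq_vecI)
    then have "poly (char_poly A) 0 = 0"
      using eigenvalue_root_char_poly[OF A] by (auto simp: eigenvalue_def)
    then show ?thesis using True by simp
  next
    case False
    have MJ: "M * ones_mat N = x \<cdot>\<^sub>m ones_mat N"
    proof (rule eq_matI)
      fix i j assume ij: "i < dim_row (x \<cdot>\<^sub>m ones_mat N)" "j < dim_col (x \<cdot>\<^sub>m ones_mat N)"
      have "(M * ones_mat N) $$ (i, j) = (\<Sum>k\<in>{0..<N}. (if i = k then x else 0) - A $$ (i, k))"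
        using ij A M by (auto simp: scalar_prod_def M_def char_matrix_def sum_negf[symmetric] intro!: sum.cong)
      then show "(M * ones_mat N) $$ (i, j) = (x \<cdot>\<^sub>m ones_mat N) $$ (i, j)"
        using ij rowsum by (simp add: sum_subtractf)
    qed (use M in auto)
    \<comment> \<open>With \<open>J\<close> the all-ones matrix, (xI - A) J = xJ gives xI - A - sJ =
      (xI - A)(I - (s/x) J), and the determinant of the second factor is known.\<close>
    have "M * (1\<^sub>m N + (- s / x) \<cdot>\<^sub>m ones_mat N) = M + (- s / x) \<cdot>\<^sub>m (M * ones_mat N)"
      using M by (simp add: mult_add_distrib_mat[of _ N N _ N] mult_smult_distrib[of _ N N _ N])
    also have "\<dots> = - char_matrix ?P x"
      unfolding MJ using False A by (auto simp: M_def char_matrix_def intro!: eq_matI)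
    finally have "det (- char_matrix ?P x) = det M * (1 - s / x * real N)"
      using det_mult[OF M, of "1\<^sub>m N + (- s / x) \<cdot>\<^sub>m ones_mat N"] det_one_plus_ones_mat[of N "- s / x"]
      by simp
    then show ?thesis
      using False A by (simp add: char_poly_matrix[of _ N] M_def field_simps)
  qed
qed

lemma sorted_list_of_multiset_Min:
  assumes "M \<noteq> {#}"
  shows "sorted_list_of_multiset M ! 0 = Min (set_mset M)"
proof -
  obtain x xs where x: "sorted_list_of_multiset M = x # xs"
    using assms by (metis list.exhaust mset_sorted_list_of_multiset mset.simps(1))
  then have "set_mset M = set (x # xs)" "sorted (x # xs)"
    by (metis set_sorted_list_of_multiset, metis sorted_sorted_list_of_multiset)
  then show ?thesis using x by (auto intro!: Min_eqI[symmetric])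
qed

section \<open>Projection onto the complement of the all-ones vector\<close>

definition centered :: "nat \<Rightarrow> real vec \<Rightarrow> real vec" where
  "centered N x = x - ((ones N \<bullet> x) / real N) \<cdot>\<^sub>v ones N"

lemma ones_carrier [simp]: "ones N \<in> carrier_vec N"
  and ones_scalar_prod_ones: "ones N \<bullet> ones N = real N"
  by (simp_all add: ones_def scalar_prod_def)

lemma centered_properties:
  assumes N: "0 < N" and x: "x \<in> carrier_vec N"
  shows centered_carrier: "centered N x \<in> carrier_vec N"
    and ones_scalar_prod_centered: "ones N \<bullet> centered N x = 0"
    and centered_scalar_prod_self: "centered N x \<bullet> centered N x = x \<bullet> x - (ones N \<bullet> x)\<^sup>2 / real N"
proof -
  define a where "a = (ones N \<bullet> x) / real N"
  have aN: "ones N \<bullet> x = a * real N" "x \<bullet> ones N = a * real N"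
    using N comm_scalar_prod[OF ones_carrier x] by (simp_all add: a_def)
  have y: "centered N x = x - a \<cdot>\<^sub>v ones N" by (simp add: centered_def a_def)
  show "centered N x \<in> carrier_vec N" using x by (simp add: y)
  show "ones N \<bullet> centered N x = 0"
    using x by (simp add: y scalar_prod_minus_distrib[of _ N] ones_scalar_prod_ones aN)
  show "centered N x \<bullet> centered N x = x \<bullet> x - (ones N \<bullet> x)\<^sup>2 / real N"
    using x N
    by (simp add: y scalar_prod_minus_distrib[of _ N] minus_scalar_prod_distrib[of _ N]
        ones_scalar_prod_ones aN power2_eq_square)
qed

text \<open>The subtracted multiple of the all-ones vector lies in the kernel, and by symmetry the
  image of \<open>A\<close> is orthogonal to it.\<close>

lemma centered_quadratic_form:
  assumes A: "A \<in> carrier_mat N N" "A\<^sup>T = A" "A *\<^sub>v ones N = 0\<^sub>v N" and x: "x \<in> carrier_vec N"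
  shows "centered N x \<bullet> (A *\<^sub>v centered N x) = x \<bullet> (A *\<^sub>v x)"
proof -
  have "A *\<^sub>v centered N x = A *\<^sub>v x"
    using A x by (simp add: centered_def mult_minus_distrib_mat_vec mult_mat_vec smult_zero_vec)
  moreover have "ones N \<bullet> (A *\<^sub>v x) = 0"
    using symmetric_scalar_prod_mult[OF A(1,2) ones_carrier x] A(3) x by simp
  ultimately show ?thesis
    using A x by (simp add: centered_def minus_scalar_prod_distrib[of _ N])
qed

text \<open>Adding a multiple of the all-ones matrix moves the eigenvalue of the all-ones vector out of
  the way, so that the other eigenvalues are governed by the form on the orthogonal complement.\<close>

lemma algebraic_connectivity_ge_iff:
  fixes A :: "real mat"
  assumes A: "A \<in> carrier_mat N N" "A\<^sup>T = A" "A *\<^sub>v ones N = 0\<^sub>v N"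
    and psd: "\<And>x. x \<in> carrier_vec N \<Longrightarrow> 0 \<le> x \<bullet> (A *\<^sub>v x)"
    and N: "2 \<le> N"
  shows "t \<le> algebraic_connectivity A \<longleftrightarrow>
    (\<forall>x\<in>carrier_vec N. ones N \<bullet> x = 0 \<longrightarrow> t * (x \<bullet> x) \<le> x \<bullet> (A *\<^sub>v x))"
proof -
  let ?Q = "\<lambda>t. \<forall>x\<in>carrier_vec N. ones N \<bullet> x = 0 \<longrightarrow> t * (x \<bullet> x) \<le> x \<bullet> (A *\<^sub>v x)"
  let ?P = "\<lambda>s. A + s \<cdot>\<^sub>m ones_mat N"
  \<comment> \<open>A single copy of 0 is removed, the one owed to the all-ones vector; further
    zeros stay, since multiplicity counts.\<close>
  define M where "M = proots (char_poly A) - {#0#}"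
  have ch0: "char_poly B \<noteq> 0" if "B \<in> carrier_mat N N" for B :: "real mat"
    using degree_monic_char_poly[OF that] by auto
  have P: "?P s \<in> carrier_mat N N" "(?P s)\<^sup>T = ?P s" for s
    using A by (auto simp: mat_eq_iff)
  have lin: "proots (p * [:- b, 1:]) = add_mset b (proots p)" if "p \<noteq> 0" for p :: "real poly" and b
    using that by (subst proots_mult) (auto simp: proots_linear_factor)
  have split: "add_mset 0 (proots (char_poly (?P s))) = add_mset (s * real N) (proots (char_poly A))" for s
    using arg_cong[OF char_poly_add_ones_mat[OF A(1,3), of s], of proots] N
      lin[OF ch0[OF P(1)[of s]], of 0] lin[OF ch0[OF A(1)], of "s * real N"] by simp
  \<comment> \<open>For \<open>s = 1\<close> the moved eigenvalue is nonzero, so the 0 added on the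
    left must occur among the roots for \<open>A\<close>.\<close>
  have rA: "proots (char_poly A) = add_mset 0 M"
    using arg_cong[OF split[of 1], of "\<lambda>M. 0 \<in># M"] N by (simp add: M_def)
  have rP: "proots (char_poly (?P s)) = add_mset (s * real N) M" for s
    using split[of s] by (simp add: rA add_mset_commute)
  have evP: "eigenvalue (?P s) e \<longleftrightarrow> e = s * real N \<or> e \<in># M" for s e
    using arg_cong[OF rP[of s], of "\<lambda>M. e \<in># M"] eigenvalue_root_char_poly[OF P(1)] ch0[OF P(1)[of s]]
    by auto
  have form: "x \<bullet> (?P s *\<^sub>v x) = x \<bullet> (A *\<^sub>v x) + s * (ones N \<bullet> x)\<^sup>2" if x: "x \<in> carrier_vec N" for x s
  proof -
    have "(s \<cdot>\<^sub>m ones_mat N) *\<^sub>v x = (s * (ones N \<bullet> x)) \<cdot>\<^sub>v ones N"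
      using x by (intro eq_vecI) (auto simp: ones_def scalar_prod_def sum_distrib_left)
    then show ?thesis
      using A x comm_scalar_prod[OF ones_carrier x]
      by (simp add: add_mult_distrib_mat_vec[of _ N N] scalar_prod_add_distrib[of _ N] power2_eq_square)
  qed
  have Q: "?Q t \<longleftrightarrow> (\<forall>e\<in>#M. t \<le> e)" for t
  proof
    assume q: "?Q t"
    \<comment> \<open>This shift moves the eigenvalue of the all-ones vector to |t|, which is at
      least t, so the bound holds in that direction whatever the sign of t.\<close>
    define s where "s = \<bar>t\<bar> / real N"
    have "t * (x \<bullet> x) \<le> x \<bullet> (?P s *\<^sub>v x)" if x: "x \<in> carrier_vec N" for x
    proof -
      define b where "b = (ones N \<bullet> x)\<^sup>2 / real N"
      have "0 < N" using N by simp
      note y = centered_properties[OF this x]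
      have "t * (x \<bullet> x - b) \<le> x \<bullet> (A *\<^sub>v x)"
        unfolding b_def using q y centered_quadratic_form[OF A x] by fastforce
      moreover have "s * (ones N \<bullet> x)\<^sup>2 = \<bar>t\<bar> * b"
        by (simp add: s_def b_def)
      moreover have "t * b \<le> \<bar>t\<bar> * b"
        by (intro mult_right_mono) (auto simp: b_def)
      ultimately show ?thesis unfolding form[OF x] right_diff_distrib by linarith
    qed
    then show "\<forall>e\<in>#M. t \<le> e" using eigenvalue_ge[OF P(1)] evP by blast
  next
    assume M: "\<forall>e\<in>#M. t \<le> e"
    \<comment> \<open>Now every eigenvalue of \<open>?P s\<close> is at least t, and on vectors
      orthogonal to all-ones the added term of the form vanishes.\<close>
    define s where "s = \<bar>t\<bar> / real N"
    have "t \<le> e" if "eigenvalue (?P s) e" for e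
      using that M N unfolding evP by (auto simp: s_def)
    from symmetric_quadratic_form_ge[OF P this] show "?Q t" using form by fastforce
  qed
  \<comment> \<open>Index 1 of the eigenvalue list must exist. With \<open>M\<close> empty, every t
    would bound the form on the complement, which fails at the nonzero vector \<open>?x\<close>,
    available as \<open>2 \<le> N\<close>.\<close>
  have "M \<noteq> {#}"
  proof
    assume "M = {#}"
    then have *: "?Q t" for t using Q by simp
    let ?x = "unit_vec N 0 - unit_vec N 1 :: real vec"
    have x: "?x \<in> carrier_vec N" by simp
    have "ones N \<bullet> ?x = 0" "?x \<bullet> ?x = 2"
      using N by (simp_all add: scalar_prod_minus_distrib[of _ N] minus_scalar_prod_distrib[of _ N] ones_def)
    then have le: "t * 2 \<le> ?x \<bullet> (A *\<^sub>v ?x)" for t using *[of t] x by fastforce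
    define q where "q = ?x \<bullet> (A *\<^sub>v ?x)"
    show False using le[of "q + 1"] le[of 1] unfolding q_def[symmetric] by simp
  qed
  moreover have "\<forall>e\<in>#M. 0 \<le> e" using Q[of 0] psd by simp
  \<comment> \<open>No element of \<open>M\<close> is negative, so the removed 0 sorts to the front
    and index 1 holds the least element of \<open>M\<close>.\<close>
  ultimately have "algebraic_connectivity A = Min (set_mset M)"
    by (simp add: algebraic_connectivity_def eigenvalue_list_def rA insort_is_Cons
        sorted_list_of_multiset_Min[symmetric])
  then show ?thesis using Q[of t] \<open>M \<noteq> {#}\<close> by simp
qed

section \<open>Laplacians and supra-Laplacians\<close>

text \<open>Covers nonnegative edge weights, so that both layers and the coupled network fall under
  one characterization of connectivity.\<close>

definition weighted_laplacian :: "nat \<Rightarrow> real mat \<Rightarrow> bool" where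
  "weighted_laplacian N L \<longleftrightarrow> L \<in> carrier_mat N N \<and> L\<^sup>T = L \<and>
     (\<forall>i<N. \<forall>j<N. i \<noteq> j \<longrightarrow> L $$ (i, j) \<le> 0) \<and> L *\<^sub>v ones N = 0\<^sub>v N"

text \<open>Symmetry and zero row sums turn the form into half the sum of
  \<open>- L $$ (i, j) * (x $ i - x $ j)\<^sup>2\<close>, where diagonal terms vanish and the others
  are nonnegative.\<close>

lemma weighted_laplacian_psd:
  assumes L: "weighted_laplacian N L" and x: "x \<in> carrier_vec N"
  shows "0 \<le> x \<bullet> (L *\<^sub>v x)"
proof -
  have C: "L \<in> carrier_mat N N" "L\<^sup>T = L" "L *\<^sub>v ones N = 0\<^sub>v N"
    and off: "\<And>i j. i < N \<Longrightarrow> j < N \<Longrightarrow> i \<noteq> j \<Longrightarrow> L $$ (i, j) \<le> 0"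
    using L by (auto simp: weighted_laplacian_def)
  have sym: "L $$ (j, i) = L $$ (i, j)" if "i < N" "j < N" for i j
    using arg_cong[OF C(2), of "\<lambda>M. M $$ (i, j)"] C(1) that by simp
  have rows: "(\<Sum>j<N. L $$ (i, j)) = 0" if "i < N" for i
    using arg_cong[OF C(3), of "\<lambda>v. v $ i"] C(1) that
    by (simp add: scalar_prod_def ones_def atLeast0LessThan)
  have 1: "(\<Sum>i<N. \<Sum>j<N. L $$ (i, j) * (x $ i)\<^sup>2) = 0"
    using rows by (simp add: sum_distrib_right[symmetric])
  have 2: "(\<Sum>i<N. \<Sum>j<N. L $$ (i, j) * (x $ j)\<^sup>2) = 0"
    by (subst sum.swap, subst 1[symmetric]) (intro sum.cong refl, simp add: sym)
  have "x \<bullet> (L *\<^sub>v x) = (\<Sum>i<N. \<Sum>j<N. L $$ (i, j) * (x $ i * x $ j))"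
    using C x by (simp add: scalar_prod_def sum_distrib_left atLeast0LessThan mult_ac)
  then have "2 * (x \<bullet> (L *\<^sub>v x)) = (\<Sum>i<N. \<Sum>j<N. L $$ (i, j) * (x $ i)\<^sup>2)
      + (\<Sum>i<N. \<Sum>j<N. L $$ (i, j) * (x $ j)\<^sup>2) + (\<Sum>i<N. \<Sum>j<N. - L $$ (i, j) * (x $ i - x $ j)\<^sup>2)"
    by (simp add: sum_distrib_left sum.distrib[symmetric] power2_eq_square algebra_simps)
  also have "\<dots> = (\<Sum>i<N. \<Sum>j<N. - L $$ (i, j) * (x $ i - x $ j)\<^sup>2)"
    using 1 2 by simp
  also have "\<dots> \<ge> 0"
  proof (intro sum_nonneg)
    fix i j assume "i \<in> {..<N}" "j \<in> {..<N}"
    then show "0 \<le> - L $$ (i, j) * (x $ i - x $ j)\<^sup>2"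
      using off[of i j] by (cases "i = j") (auto intro!: mult_nonpos_nonneg)
  qed
  finally show ?thesis by simp
qed

lemma weighted_laplacian_connectivity_ge_iff:
  assumes L: "weighted_laplacian N L" and N: "2 \<le> N"
  shows "t \<le> algebraic_connectivity L \<longleftrightarrow>
    (\<forall>x\<in>carrier_vec N. ones N \<bullet> x = 0 \<longrightarrow> t * (x \<bullet> x) \<le> x \<bullet> (L *\<^sub>v x))"
  using algebraic_connectivity_ge_iff[OF _ _ _ _ N, of L t] weighted_laplacian_psd[OF L] L
  by (auto simp: weighted_laplacian_def)

text \<open>Arcs leaving a node correspond to their heads, so the out-degree is a row sum of the
  adjacency matrix; symmetry of the arc set gives symmetry of the matrix.\<close>

lemma weighted_laplacian_laplacian:
  assumes "graph_on n G"
  shows "weighted_laplacian n (laplacian G)"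
proof -
  interpret pair_graph G using assms by (simp add: graph_on_def)
  have V: "pverts G = {..<n}" using assms by (simp add: graph_on_def)
  have E: "(i, j) \<in> parcs G \<Longrightarrow> j < n" for i j
    using in_arcsD2[of i j] V by auto
  have "out_degree (with_proj G) i = (\<Sum>j<n. if (i, j) \<in> parcs G then 1 else 0)" for i
  proof -
    have "out_arcs (with_proj G) i = Pair i ` {j. j < n \<and> (i, j) \<in> parcs G}"
      using E by (auto simp: out_arcs_def)
    then have "out_degree (with_proj G) i = card {j. j < n \<and> (i, j) \<in> parcs G}"
      by (simp add: out_degree_def card_image inj_on_def)
    also have "\<dots> = (\<Sum>j<n. if (i, j) \<in> parcs G then 1 else 0)"
      by (simp add: sum.If_cases lessThan_def Int_def)
    finally show ?thesis .
  qed
  then have deg: "real (out_degree (with_proj G) i) = (\<Sum>j<n. if (i, j) \<in> parcs G then 1 else 0)" for i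
    by (simp add: of_nat_sum if_distrib cong: if_cong)
  have "laplacian G *\<^sub>v ones n = 0\<^sub>v n"
    using V
    by (intro eq_vecI) (auto simp: laplacian_def adjacency_mat_def mat_diag_def ones_def scalar_prod_def
        sum_subtractf deg atLeast0LessThan)
  moreover have "(i, j) \<in> parcs G \<longleftrightarrow> (j, i) \<in> parcs G" for i j
    using arcs_symmetric by blast
  ultimately show ?thesis
    using V by (auto simp: weighted_laplacian_def laplacian_def adjacency_mat_def mat_diag_def
        intro!: eq_matI)
qed

section \<open>Block structure and quadratic form of the supra-Laplacian\<close>

lemma diag_of_vec_mult:
  assumes "v \<in> carrier_vec k" "x \<in> carrier_vec k"
  shows "diag_of_vec v *\<^sub>v x = vec k (\<lambda>i. v $ i * x $ i)"
proof (intro eq_vecI)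
  fix i assume "i < dim_vec (vec k (\<lambda>i. v $ i * x $ i))"
  then show "(diag_of_vec v *\<^sub>v x) $ i = vec k (\<lambda>i. v $ i * x $ i) $ i"
    using assms by (simp add: diag_of_vec_def mat_diag_def scalar_prod_def
        if_distrib[of "\<lambda>z. z * y" for y] cong: if_cong)
qed (use assms in \<open>simp add: diag_of_vec_def mat_diag_def\<close>)

context
  fixes n m :: nat and L1 L2 W :: "real mat"
  assumes L1: "weighted_laplacian n L1" and L2: "weighted_laplacian m L2"
    and W: "W \<in> carrier_mat n m"
begin

lemma supra_laplacian_carrier_blocks:
  "L1 + diag_of_vec (W *\<^sub>v ones m) \<in> carrier_mat n n" "- W \<in> carrier_mat n m"
  "- W\<^sup>T \<in> carrier_mat m n" "L2 + diag_of_vec (W\<^sup>T *\<^sub>v ones n) \<in> carrier_mat m m"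
  using L1 L2 W by (auto simp: weighted_laplacian_def diag_of_vec_def mat_diag_def)

text \<open>The diagonal link strengths merge with the off-diagonal blocks into differences across
  the links, a form from which both the kernel and the energy can be read off.\<close>

lemma supra_laplacian_mult_append:
  assumes u: "u \<in> carrier_vec n" and v: "v \<in> carrier_vec m"
  shows "supra_laplacian L1 L2 W *\<^sub>v (u @\<^sub>v v) =
    (L1 *\<^sub>v u + vec n (\<lambda>i. \<Sum>j<m. W $$ (i, j) * (u $ i - v $ j))) @\<^sub>v
    (L2 *\<^sub>v v + vec m (\<lambda>j. \<Sum>i<n. W $$ (i, j) * (v $ j - u $ i)))"
proof -
  have d: "diag_of_vec (W *\<^sub>v ones m) \<in> carrier_mat n n" "diag_of_vec (W\<^sup>T *\<^sub>v ones n) \<in> carrier_mat m m"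
    and l: "L1 \<in> carrier_mat n n" "L2 \<in> carrier_mat m m"
    using L1 L2 W by (auto simp: weighted_laplacian_def diag_of_vec_def mat_diag_def)
  have o: "W *\<^sub>v ones m \<in> carrier_vec n" "W\<^sup>T *\<^sub>v ones n \<in> carrier_vec m"
    using W by (auto simp: ones_def)
  have "(L1 + diag_of_vec (W *\<^sub>v ones m)) *\<^sub>v u + - W *\<^sub>v v =
      L1 *\<^sub>v u + vec n (\<lambda>i. \<Sum>j<m. W $$ (i, j) * (u $ i - v $ j))"
    unfolding add_mult_distrib_mat_vec[OF l(1) d(1) u] diag_of_vec_mult[OF o(1) u]
    using W u v l
    by (intro eq_vecI) (auto simp: scalar_prod_def ones_def sum_subtractf sum_negf right_diff_distrib
        sum_distrib_right atLeast0LessThan)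
  moreover have "- W\<^sup>T *\<^sub>v u + (L2 + diag_of_vec (W\<^sup>T *\<^sub>v ones n)) *\<^sub>v v =
      L2 *\<^sub>v v + vec m (\<lambda>j. \<Sum>i<n. W $$ (i, j) * (v $ j - u $ i))"
    unfolding add_mult_distrib_mat_vec[OF l(2) d(2) v] diag_of_vec_mult[OF o(2) v]
    using W u v l
    by (intro eq_vecI) (auto simp: scalar_prod_def ones_def sum_subtractf sum_negf right_diff_distrib
        sum_distrib_right atLeast0LessThan)
  ultimately show ?thesis
    using W four_block_mat_mult_vec[OF supra_laplacian_carrier_blocks u v]
    by (simp add: supra_laplacian_def)
qed

lemma supra_laplacian_quadratic_form:
  assumes u: "u \<in> carrier_vec n" and v: "v \<in> carrier_vec m"
  shows "(u @\<^sub>v v) \<bullet> (supra_laplacian L1 L2 W *\<^sub>v (u @\<^sub>v v)) =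
    u \<bullet> (L1 *\<^sub>v u) + v \<bullet> (L2 *\<^sub>v v) + (\<Sum>i<n. \<Sum>j<m. W $$ (i, j) * (u $ i - v $ j)\<^sup>2)"
proof -
  let ?p = "vec n (\<lambda>i. \<Sum>j<m. W $$ (i, j) * (u $ i - v $ j))"
  let ?q = "vec m (\<lambda>j. \<Sum>i<n. W $$ (i, j) * (v $ j - u $ i))"
  have l: "L1 *\<^sub>v u \<in> carrier_vec n" "L2 *\<^sub>v v \<in> carrier_vec m"
    using L1 L2 u v by (auto simp: weighted_laplacian_def)
  have "u \<bullet> ?p + v \<bullet> ?q = (\<Sum>i<n. \<Sum>j<m. W $$ (i, j) * (u $ i - v $ j) * u $ i)
      + (\<Sum>j<m. \<Sum>i<n. W $$ (i, j) * (v $ j - u $ i) * v $ j)"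
    by (simp add: scalar_prod_def atLeast0LessThan sum_distrib_left mult_ac)
  also have "\<dots> = (\<Sum>i<n. \<Sum>j<m. W $$ (i, j) * (u $ i - v $ j)\<^sup>2)"
    \<comment> \<open>Each link is met once from either side: w (a - b) a + w (b - a) b = w (a -
      b)^2.\<close>
    by (subst (2) sum.swap) (simp add: sum.distrib[symmetric] power2_eq_square algebra_simps)
  finally show ?thesis
    using l u v supra_laplacian_mult_append[OF u v]
    by (simp add: scalar_prod_append[of _ n _ m] scalar_prod_add_distrib[of _ n] scalar_prod_add_distrib[of _ m])
qed

text \<open>Makes the characterization of connectivity available for the coupled network.
  Nonnegative weights give the sign of the entries between the layers.\<close>

lemma weighted_laplacian_supra_laplacian:
  assumes nn: "\<And>i j. i < n \<Longrightarrow> j < m \<Longrightarrow> 0 \<le> W $$ (i, j)"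
  shows "weighted_laplacian (n + m) (supra_laplacian L1 L2 W)"
  unfolding weighted_laplacian_def
proof (intro conjI allI impI)
  have dim: "dim_row W = n" "dim_col W = m" using W by auto
  note blocks = supra_laplacian_carrier_blocks
  have d: "diag_of_vec (W *\<^sub>v ones m) \<in> carrier_mat n n" "diag_of_vec (W\<^sup>T *\<^sub>v ones n) \<in> carrier_mat m m"
    using W by (auto simp: diag_of_vec_def mat_diag_def)
  have l: "L1 \<in> carrier_mat n n" "L2 \<in> carrier_mat m m" "L1\<^sup>T = L1" "L2\<^sup>T = L2"
    "L1 *\<^sub>v ones n = 0\<^sub>v n" "L2 *\<^sub>v ones m = 0\<^sub>v m"
    using L1 L2 by (auto simp: weighted_laplacian_def)
  show "supra_laplacian L1 L2 W \<in> carrier_mat (n + m) (n + m)"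
    using blocks by (auto simp: supra_laplacian_def dim)
  have "(diag_of_vec x)\<^sup>T = diag_of_vec x" for x :: "real vec"
    by (auto simp: diag_of_vec_def mat_diag_def intro!: eq_matI)
  then have "(L1 + diag_of_vec (W *\<^sub>v ones m))\<^sup>T = L1 + diag_of_vec (W *\<^sub>v ones m)"
    "(L2 + diag_of_vec (W\<^sup>T *\<^sub>v ones n))\<^sup>T = L2 + diag_of_vec (W\<^sup>T *\<^sub>v ones n)"
    using l d by (simp_all add: transpose_add[of _ n n] transpose_add[of _ m m])
  moreover have "(- W)\<^sup>T = - W\<^sup>T" "(- W\<^sup>T)\<^sup>T = - W"
    by (auto intro!: eq_matI)
  ultimately show "(supra_laplacian L1 L2 W)\<^sup>T = supra_laplacian L1 L2 W"
    using transpose_four_block_mat[OF blocks] by (simp add: supra_laplacian_def dim)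
  show "supra_laplacian L1 L2 W $$ (i, j) \<le> 0" if "i < n + m" "j < n + m" "i \<noteq> j" for i j
    using that nn L1 L2 W blocks
    by (auto simp: supra_laplacian_def weighted_laplacian_def diag_of_vec_def mat_diag_def dim)
  have "ones (n + m) = ones n @\<^sub>v ones m"
    by (auto simp: ones_def append_vec_def Let_def intro!: eq_vecI)
  moreover have "supra_laplacian L1 L2 W *\<^sub>v (ones n @\<^sub>v ones m) = 0\<^sub>v n @\<^sub>v 0\<^sub>v m"
    using supra_laplacian_mult_append[of "ones n" "ones m"] l
    by (auto simp: ones_def intro!: arg_cong2[of _ _ _ _ append_vec] eq_vecI)
  ultimately show "supra_laplacian L1 L2 W *\<^sub>v ones (n + m) = 0\<^sub>v (n + m)"
    by (auto intro!: eq_vecI)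
qed

end

section \<open>Upper bound for all admissible weights\<close>

text \<open>A vector constant on each layer has no energy inside the layers, and each link
  contributes its weight times the same factor. Its Rayleigh quotient thus depends on
  \<open>W\<close> only through the total \<open>c\<close>.\<close>

lemma supra_connectivity_le:
  assumes L1: "weighted_laplacian n L1" and L2: "weighted_laplacian m L2"
    and n: "2 \<le> n" and m: "2 \<le> m" and adm: "W \<in> admissible_weights n m c"
  shows "algebraic_connectivity (supra_laplacian L1 L2 W) \<le> (1 / real n + 1 / real m) * c"
proof -
  have W: "W \<in> carrier_mat n m" "\<And>i j. i < n \<Longrightarrow> j < m \<Longrightarrow> 0 \<le> W $$ (i, j)"
    and c: "ones n \<bullet> (W *\<^sub>v ones m) = c"
    using adm by (auto simp: admissible_weights_def)
  let ?L = "supra_laplacian L1 L2 W" and ?u = "real m \<cdot>\<^sub>v ones n" and ?v = "- real n \<cdot>\<^sub>v ones m"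
  have u: "?u \<in> carrier_vec n" and v: "?v \<in> carrier_vec m" and o: "ones k \<in> carrier_vec k" for k
    by (auto simp: ones_def)
  have on: "ones (n + m) = ones n @\<^sub>v ones m"
    by (auto simp: ones_def append_vec_def Let_def intro!: eq_vecI)
  have oo: "ones k \<bullet> ones k = real k" for k by (simp add: ones_def scalar_prod_def)
  have "ones (n + m) \<bullet> (?u @\<^sub>v ?v) = 0"
    unfolding on using o u v
    by (simp add: scalar_prod_append[of _ n _ m] scalar_prod_smult_distrib[of _ n]
        scalar_prod_smult_distrib[of _ m] oo)
  \<comment> \<open>The characterization is used with t equal to the connectivity itself.\<close>
  then have "algebraic_connectivity ?L * ((?u @\<^sub>v ?v) \<bullet> (?u @\<^sub>v ?v)) \<le> (?u @\<^sub>v ?v) \<bullet> (?L *\<^sub>v (?u @\<^sub>v ?v))"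
    using weighted_laplacian_connectivity_ge_iff[OF weighted_laplacian_supra_laplacian[OF L1 L2 W],
        of "algebraic_connectivity ?L"] n u v by auto
  also have "(?u @\<^sub>v ?v) \<bullet> (?L *\<^sub>v (?u @\<^sub>v ?v)) = (\<Sum>i<n. \<Sum>j<m. W $$ (i, j) * (real m + real n)\<^sup>2)"
  proof -
    have "L1 *\<^sub>v ?u = 0\<^sub>v n" "L2 *\<^sub>v ?v = 0\<^sub>v m"
      using L1 L2 o
      by (simp_all add: weighted_laplacian_def mult_mat_vec[of _ n n] mult_mat_vec[of _ m m] smult_zero_vec)
    then show ?thesis
      unfolding supra_laplacian_quadratic_form[OF L1 L2 W(1) u v] by (simp add: ones_def)
  qed
  also have "\<dots> = c * (real m + real n)\<^sup>2"
    using W c by (simp add: ones_def scalar_prod_def atLeast0LessThan sum_distrib_right[symmetric])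
  also have "(?u @\<^sub>v ?v) \<bullet> (?u @\<^sub>v ?v) = real n * real m * (real m + real n)"
    using o u v
    by (simp add: scalar_prod_append[of _ n _ m] scalar_prod_smult_distrib[of _ n]
        scalar_prod_smult_distrib[of _ m] smult_scalar_prod_distrib[of _ n]
        smult_scalar_prod_distrib[of _ m] oo algebra_simps)
  finally have "algebraic_connectivity ?L * (real n * real m) * (real m + real n)
      \<le> c * (real m + real n) * (real m + real n)"
    by (simp add: power2_eq_square mult_ac)
  then have "algebraic_connectivity ?L * (real n * real m) \<le> c * (real m + real n)"
    using n by (subst (asm) mult_le_cancel_right) auto
  then show ?thesis using n m by (simp add: field_simps)
qed

section \<open>Lower bound for uniform weights\<close>

text \<open>Centering extends the bound to all vectors. This matters because a vector orthogonal to
  all-ones on the whole network need not be so on a single layer.\<close>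

lemma weighted_laplacian_form_ge:
  assumes L: "weighted_laplacian N L" and N: "2 \<le> N" and u: "u \<in> carrier_vec N"
  shows "algebraic_connectivity L * (u \<bullet> u - (ones N \<bullet> u)\<^sup>2 / real N) \<le> u \<bullet> (L *\<^sub>v u)"
proof -
  have "0 < N" using N by simp
  note y = centered_properties[OF this u]
  have "algebraic_connectivity L * (centered N u \<bullet> centered N u) \<le> centered N u \<bullet> (L *\<^sub>v centered N u)"
    using weighted_laplacian_connectivity_ge_iff[OF L N, of "algebraic_connectivity L"] y(1,2) by auto
  then show ?thesis
    using y(3) centered_quadratic_form[of L N u] L u by (simp add: weighted_laplacian_def)
qed

text \<open>Cauchy-Schwarz against the all-ones vector. It keeps the centered norm nonnegative when
  a connectivity is replaced by a smaller constant.\<close>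

lemma ones_scalar_prod_square_le:
  assumes "0 < N" and "u \<in> carrier_vec N"
  shows "(ones N \<bullet> u)\<^sup>2 / real N \<le> u \<bullet> u"
  using centered_scalar_prod_self[OF assms] scalar_prod_self_nonneg[of "centered N u"] by simp

text \<open>The energy on the complete bipartite graph between the layers, expressed by norms and
  coordinate sums.\<close>

lemma sum_sum_diff_square:
  fixes u v :: "real vec"
  assumes u: "u \<in> carrier_vec n" and v: "v \<in> carrier_vec m"
  shows "(\<Sum>i<n. \<Sum>j<m. (u $ i - v $ j)\<^sup>2) =
    real m * (u \<bullet> u) + real n * (v \<bullet> v) - 2 * (ones n \<bullet> u) * (ones m \<bullet> v)"
proof -
  have "(\<Sum>i<n. \<Sum>j<m. (u $ i - v $ j)\<^sup>2) = (\<Sum>i<n. \<Sum>j<m. (u $ i)\<^sup>2) + (\<Sum>i<n. \<Sum>j<m. (v $ j)\<^sup>2)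
     - 2 * (\<Sum>i<n. \<Sum>j<m. u $ i * v $ j)"
    by (simp only: sum_distrib_left sum.distrib[symmetric] sum_subtractf[symmetric])
      (simp add: power2_diff mult.assoc)
  also have "(\<Sum>i<n. \<Sum>j<m. u $ i * v $ j) = (\<Sum>i<n. u $ i) * (\<Sum>j<m. v $ j)"
    by (simp add: sum_product)
  finally show ?thesis
    using u v by (simp add: scalar_prod_def ones_def atLeast0LessThan power2_eq_square
        sum_distrib_left[symmetric])
qed

lemma supra_connectivity_uniform_ge:
  assumes L1: "weighted_laplacian n L1" and L2: "weighted_laplacian m L2"
    and n: "2 \<le> n" and m: "2 \<le> m" and c: "0 \<le> c"
    and c1: "c \<le> real m * algebraic_connectivity L1" and c2: "c \<le> real n * algebraic_connectivity L2"
  shows "(1 / real n + 1 / real m) * c \<le>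
    algebraic_connectivity (supra_laplacian L1 L2 (mat n m (\<lambda>_. c / (real n * real m))))"
proof -
  let ?W = "mat n m (\<lambda>_. c / (real n * real m))"
  let ?t = "(1 / real n + 1 / real m) * c"
  have W: "?W \<in> carrier_mat n m" "\<And>i j. i < n \<Longrightarrow> j < m \<Longrightarrow> 0 \<le> ?W $$ (i, j)"
    using c by auto
  have "?t * (x \<bullet> x) \<le> x \<bullet> (supra_laplacian L1 L2 ?W *\<^sub>v x)"
    if x: "x \<in> carrier_vec (n + m)" and ox: "ones (n + m) \<bullet> x = 0" for x
  proof -
    define u v where "u = vec_first x n" and "v = vec_last x m"
    have xuv: "x = u @\<^sub>v v" and u: "u \<in> carrier_vec n" and v: "v \<in> carrier_vec m"
      using x by (auto simp: u_def v_def)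
    have o: "ones k \<in> carrier_vec k" for k by (simp add: ones_def)
    have on: "ones (n + m) = ones n @\<^sub>v ones m"
      by (auto simp: ones_def append_vec_def Let_def intro!: eq_vecI)
    define s where "s = ones n \<bullet> u"
    have ou: "ones n \<bullet> u = s" and ov: "ones m \<bullet> v = - s"
      using ox o u v unfolding on xuv by (auto simp: s_def scalar_prod_append[of _ n _ m])
    \<comment> \<open>The bound on \<open>c\<close> allows the connectivity to be lowered to
      \<open>c / real m\<close>, the value for which the terms in \<open>s\<close> later cancel; the
      other layer is treated alike.\<close>
    have a: "c / real m * (u \<bullet> u - s\<^sup>2 / real n) \<le> u \<bullet> (L1 *\<^sub>v u)"
    proof -
      have "c / real m * (u \<bullet> u - s\<^sup>2 / real n) \<le> algebraic_connectivity L1 * (u \<bullet> u - s\<^sup>2 / real n)"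
        using c1 m n ones_scalar_prod_square_le[of n u] u ou
        by (intro mult_right_mono) (auto simp: field_simps)
      then show ?thesis using weighted_laplacian_form_ge[OF L1 n u] ou by simp
    qed
    have b: "c / real n * (v \<bullet> v - s\<^sup>2 / real m) \<le> v \<bullet> (L2 *\<^sub>v v)"
    proof -
      have "c / real n * (v \<bullet> v - s\<^sup>2 / real m) \<le> algebraic_connectivity L2 * (v \<bullet> v - s\<^sup>2 / real m)"
        using c2 m n ones_scalar_prod_square_le[of m v] v ov
        by (intro mult_right_mono) (auto simp: field_simps)
      then show ?thesis using weighted_laplacian_form_ge[OF L2 m v] ov by simp
    qed
    have "(\<Sum>i<n. \<Sum>j<m. ?W $$ (i, j) * (u $ i - v $ j)\<^sup>2) =
        c / (real n * real m) * (\<Sum>i<n. \<Sum>j<m. (u $ i - v $ j)\<^sup>2)"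
      by (simp add: sum_distrib_left)
    also have "\<dots> = c / (real n * real m) * (real m * (u \<bullet> u) + real n * (v \<bullet> v) + 2 * s\<^sup>2)"
      using sum_sum_diff_square[OF u v] by (simp add: ou ov power2_eq_square)
    finally have "x \<bullet> (supra_laplacian L1 L2 ?W *\<^sub>v x) = u \<bullet> (L1 *\<^sub>v u) + v \<bullet> (L2 *\<^sub>v v)
        + c / (real n * real m) * (real m * (u \<bullet> u) + real n * (v \<bullet> v) + 2 * s\<^sup>2)"
      using supra_laplacian_quadratic_form[OF L1 L2 W(1) u v] xuv by simp
    also have "\<dots> \<ge> c / real m * (u \<bullet> u - s\<^sup>2 / real n) + c / real n * (v \<bullet> v - s\<^sup>2 / real m)
        + c / (real n * real m) * (real m * (u \<bullet> u) + real n * (v \<bullet> v) + 2 * s\<^sup>2)"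
      using a b by simp
    \<comment> \<open>Centering costs c s^2/(nm) in each layer, and the links give back exactly 2 c
      s^2/(nm).\<close>
    also have "c / real m * (u \<bullet> u - s\<^sup>2 / real n) + c / real n * (v \<bullet> v - s\<^sup>2 / real m)
        + c / (real n * real m) * (real m * (u \<bullet> u) + real n * (v \<bullet> v) + 2 * s\<^sup>2)
        = ?t * (u \<bullet> u + v \<bullet> v)"
      using n m by (simp add: field_simps)
    also have "u \<bullet> u + v \<bullet> v = x \<bullet> x"
      unfolding xuv using u v by (simp add: scalar_prod_append[of _ n _ m])
    finally show ?thesis .
  qed
  then show ?thesis
    using weighted_laplacian_connectivity_ge_iff[OF weighted_laplacian_supra_laplacian[OF L1 L2 W], of ?t] n
    by auto
qed

theorem mainTheorem6:
  fixes G1 G2 :: "nat pair_pre_digraph" and n m :: nat and c c_star :: real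
  defines "c_star \<equiv> min (real m * algebraic_connectivity (laplacian G1))
                        (real n * algebraic_connectivity (laplacian G2))"
  assumes "2 \<le> n" and "2 \<le> m"
    and "graph_on n G1" and "Digraph_Component.connected (with_proj G1)"
    and "graph_on m G2" and "Digraph_Component.connected (with_proj G2)"
    and "0 \<le> c" and "c \<le> c_star"
  shows "is_arg_max (\<lambda>W. algebraic_connectivity (supra_laplacian (laplacian G1) (laplacian G2) W))
           (\<lambda>W. W \<in> admissible_weights n m c) (mat n m (\<lambda>_. c / (real n * real m))) \<and>
         algebraic_connectivity (supra_laplacian (laplacian G1) (laplacian G2)
           (mat n m (\<lambda>_. c / (real n * real m)))) = (1 / real n + 1 / real m) * c"
proof -
  let ?W = "mat n m (\<lambda>_. c / (real n * real m))"
  let ?f = "\<lambda>W. algebraic_connectivity (supra_laplacian (laplacian G1) (laplacian G2) W)"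
  have L: "weighted_laplacian n (laplacian G1)" "weighted_laplacian m (laplacian G2)"
    using assms by (auto intro: weighted_laplacian_laplacian)
  have adm: "?W \<in> admissible_weights n m c"
    using assms by (auto simp: admissible_weights_def ones_def scalar_prod_def)
  have le: "?f W \<le> (1 / real n + 1 / real m) * c" if "W \<in> admissible_weights n m c" for W
    using supra_connectivity_le[OF L assms(2,3) that] .
  moreover have "(1 / real n + 1 / real m) * c \<le> ?f ?W"
    using supra_connectivity_uniform_ge[OF L assms(2,3,8)] assms(9) by (simp add: c_star_def)
  ultimately have "?f ?W = (1 / real n + 1 / real m) * c"
    using adm by (meson order_antisym)
  \<comment> \<open>\<open>is_arg_max\<close> asks that no admissible value be strictly larger,
    which the upper bound yields once it is attained.\<close>
  then show ?thesis
    using adm le by (auto simp: is_arg_max_def not_less)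
qed

end
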